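(* Let $T$ be a triassociative algebra. Then $T^{<n>}=T^{\{n\}}=T^n$ for all $n\in\mathbb{N}$, where the three sequences are defined by $$T^{<1>}=T,\quad T^{<n+1>}=T^{<n>}\lozenge T;\qquad T^{\{1\}}=T,\quad T^{\{n+1\}}=T\lozenge T^{\{n\}};$$ $$T^1=T,\quad T^{n+1}=T^1\lozenge T^n+T^2\lozenge T^{n-1}+\cdots+T^n\lozenge T^1.$$
   Context: A triassociative algebra $(T,\vdash,\dashv,\perp)$ is a vector space $T$ over a field with three bilinear products $\vdash,\dashv,\perp:T\times T\to T$ satisfying, for all $x,y,z\in T$: (A1) $(x\vdash y)\vdash z=x\vdash(y\vdash z)$; (A2) $(x\dashv y)\dashv z=x\dashv(y\dashv z)$; (D1) $(x\dashv y)\vdash z=x\vdash(y\vdash z)$; (D2) $(x\dashv y)\dashv z=x\dashv(y\vdash z)$; (S1) $(x\vdash y)\dashv z=x\vdash(y\dashv z)$; (T1) $(x\perp y)\vdash z=x\vdash(y\vdash z)$; (T2) $(x\dashv y)\dashv z=x\dashv(y\perp z)$; (T3) $(x\vdash y)\perp z=x\vdash(y\perp z)$; (T4) $(x\perp y)\dashv z=x\perp(y\dashv z)$; (S2) $(x\dashv y)\perp z=x\perp(y\vdash z)$; (A3) $(x\perp y)\perp z=x\perp(y\perp z)$. For subspaces $A,B\subseteq T$ and $\ast\in\{\vdash,\dashv,\perp\}$, $A\ast B$ is the span of all $a\ast b$ with $a\in A$, $b\in B$, and $A\lozenge B=A\vdash B+A\dashv B+A\perp B$. Here $\mathbb{N}=\{1,2,3,\dots\}$.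 *)

theory Defs
  imports Complex_Main "HOL-Library.Set_Algebras"
begin

definition bilinear_product ::
  "('k::field \<Rightarrow> 'a::ab_group_add \<Rightarrow> 'a) \<Rightarrow> ('a \<Rightarrow> 'a \<Rightarrow> 'a) \<Rightarrow> bool" where
  "bilinear_product scale m \<longleftrightarrow>
     (\<forall>x. Vector_Spaces.linear scale scale (\<lambda>y. m x y)) \<and>
     (\<forall>y. Vector_Spaces.linear scale scale (\<lambda>x. m x y))"

text \<open>The underlying space \<open>T\<close> is the whole type \<open>'a\<close>, so \<open>T\<close> as a subspace of itself is \<open>UNIV\<close>.\<close>

locale triassociative_algebra = vector_space scale
  for scale :: "'k::field \<Rightarrow> 'a::ab_group_add \<Rightarrow> 'a" +
  fixes vd :: "'a \<Rightarrow> 'a \<Rightarrow> 'a" (infixl "\<turnstile>" 70)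
    and dv :: "'a \<Rightarrow> 'a \<Rightarrow> 'a" (infixl "\<stileturn>" 70)
    and pp :: "'a \<Rightarrow> 'a \<Rightarrow> 'a" (infixl "\<perp>" 70)
  assumes bilinear_vd: "bilinear_product scale (\<turnstile>)"
    and bilinear_dv: "bilinear_product scale (\<stileturn>)"
    and bilinear_pp: "bilinear_product scale (\<perp>)"
    and A1: "(x \<turnstile> y) \<turnstile> z = x \<turnstile> (y \<turnstile> z)"
    and A2: "(x \<stileturn> y) \<stileturn> z = x \<stileturn> (y \<stileturn> z)"
    and D1: "(x \<stileturn> y) \<turnstile> z = x \<turnstile> (y \<turnstile> z)"
    and D2: "(x \<stileturn> y) \<stileturn> z = x \<stileturn> (y \<turnstile> z)"
    and S1: "(x \<turnstile> y) \<stileturn> z = x \<turnstile> (y \<stileturn> z)"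
    and T1: "(x \<perp> y) \<turnstile> z = x \<turnstile> (y \<turnstile> z)"
    and T2: "(x \<stileturn> y) \<stileturn> z = x \<stileturn> (y \<perp> z)"
    and T3: "(x \<turnstile> y) \<perp> z = x \<turnstile> (y \<perp> z)"
    and T4: "(x \<perp> y) \<stileturn> z = x \<perp> (y \<stileturn> z)"
    and S2: "(x \<stileturn> y) \<perp> z = x \<perp> (y \<turnstile> z)"
    and A3: "(x \<perp> y) \<perp> z = x \<perp> (y \<perp> z)"
begin

definition span_prod :: "('a \<Rightarrow> 'a \<Rightarrow> 'a) \<Rightarrow> 'a set \<Rightarrow> 'a set \<Rightarrow> 'a set" where
  "span_prod m A B = span {m a b |a b. a \<in> A \<and> b \<in> B}"

text \<open>Here and in \<open>full_power\<close>, \<open>+\<close> and \<open>\<Sum>\<close> on sets are the elementwise operations of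
  \<open>HOL-Library.Set_Algebras\<close>, i.e. sums of subspaces.\<close>

definition lozenge :: "'a set \<Rightarrow> 'a set \<Rightarrow> 'a set" (infixl "\<lozenge>" 70) where
  "A \<lozenge> B = span_prod (\<turnstile>) A B + span_prod (\<stileturn>) A B + span_prod (\<perp>) A B"

text \<open>The three sequences are indexed from 1; their value at index 0 is a dummy, which does not enter
  the values at positive indices. They are, in order, \<open>T\<^bsup><n>\<^esup>\<close>, \<open>T\<^bsup>{n}\<^esup>\<close> and \<open>T\<^bsup>n\<^esup>\<close>.\<close>

fun left_power :: "nat \<Rightarrow> 'a set" where
  "left_power 0 = {0}"
| "left_power (Suc 0) = UNIV"
| "left_power (Suc (Suc n)) = left_power (Suc n) \<lozenge> UNIV"

fun right_power :: "nat \<Rightarrow> 'a set" where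
  "right_power 0 = {0}"
| "right_power (Suc 0) = UNIV"
| "right_power (Suc (Suc n)) = UNIV \<lozenge> right_power (Suc n)"

function full_power :: "nat \<Rightarrow> 'a set" where
  "full_power 0 = {0}"
| "full_power (Suc 0) = UNIV"
| "full_power (Suc (Suc n)) =
     (\<Sum>i=1..Suc n. full_power i \<lozenge> full_power (Suc (Suc n) - i))"
  by pat_completeness auto
termination by (relation "measure id") auto

end

end

theory Submission
  imports Defs
begin

text \<open>
  The eleven axioms say more than is apparent from reading them one by one. There are nine ways to
  choose an outer and an inner product in \<open>(x \<circ> y) \<bullet> z\<close>, and each occurs as a
  left-hand side, so every left-bracketed product of three elements is a right-bracketed one;
  the nine choices for \<open>x \<circ> (y \<bullet> z)\<close> all occur as right-hand sides, so the converse
  holds too. Rebracketing may change the two products involved, but it never leaves the family of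
  the three, and \<open>A \<lozenge> B\<close> is the span of all values of that whole family on \<open>A\<close> and \<open>B\<close>.
  This makes \<open>\<lozenge>\<close> an associative operation (\<open>lozenge_assoc\<close>), and associativity is all that the
  three sequences need: it gives \<open>T\<^bsup><i>\<^esup> \<lozenge> T\<^bsup><j>\<^esup> = T\<^bsup><i+j>\<^esup>\<close> for \<open>i, j \<ge> 1\<close> by induction on
  \<open>j\<close> (\<open>left_power_lozenge\<close>). The case \<open>i = 1\<close> is the recursion of \<open>T\<^bsup>{n}\<^esup>\<close>, and in
  the recursion of \<open>T\<^bsup>n\<^esup>\<close> all summands coincide with one subspace, whose sum with itself is itself.
\<close>

context triassociative_algebra
begin

definition products :: "'a set \<Rightarrow> 'a set \<Rightarrow> 'a set" where
  "products A B = {m a b |m a b. m \<in> {(\<turnstile>), (\<stileturn>), (\<perp>)} \<and> a \<in> A \<and> b \<in> B}"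

lemma mem_products:
  assumes "m \<in> {(\<turnstile>), (\<stileturn>), (\<perp>)}" "a \<in> A" "b \<in> B"
  shows "m a b \<in> products A B"
  using assms unfolding products_def by blast

lemma span_Un_eq_plus: "span (A \<union> B) = span A + span B"
  unfolding span_Un set_plus_def by blast

lemma lozenge_eq_span: "A \<lozenge> B = span (products A B)"
proof -
  have "products A B = {a \<turnstile> b |a b. a \<in> A \<and> b \<in> B} \<union> {a \<stileturn> b |a b. a \<in> A \<and> b \<in> B}
          \<union> {a \<perp> b |a b. a \<in> A \<and> b \<in> B}"
    unfolding products_def by blast
  then show ?thesis
    by (simp only: lozenge_def span_prod_def span_Un_eq_plus)
qed

text \<open>Several axioms share a right-hand side ((A1), (D1), (T1)) or a left-hand side ((A2), (D2), (T2)).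
  One axiom for each of the nine pairs of products suffices in either direction, and the two
  directions make different choices.\<close>

lemma rebracket_right:
  assumes "m \<in> {(\<turnstile>), (\<stileturn>), (\<perp>)}" and "m' \<in> {(\<turnstile>), (\<stileturn>), (\<perp>)}"
  shows "\<exists>p\<in>{(\<turnstile>), (\<stileturn>), (\<perp>)}. \<exists>q\<in>{(\<turnstile>), (\<stileturn>), (\<perp>)}. m (m' a b) c = p a (q b c)"
  using assms by (auto simp: A1 A2 A3 D1 S1 S2 T1 T3 T4)

lemma rebracket_left:
  assumes "m \<in> {(\<turnstile>), (\<stileturn>), (\<perp>)}" and "m' \<in> {(\<turnstile>), (\<stileturn>), (\<perp>)}"
  shows "\<exists>p\<in>{(\<turnstile>), (\<stileturn>), (\<perp>)}. \<exists>q\<in>{(\<turnstile>), (\<stileturn>), (\<perp>)}. m a (m' b c) = p (q a b) c"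
  using assms by (auto simp: A1[symmetric] A2[symmetric] A3[symmetric] D2[symmetric] S1[symmetric]
      S2[symmetric] T2[symmetric] T3[symmetric] T4[symmetric])

lemma products_assoc: "products (products A B) C = products A (products B C)"
proof (intro subset_antisym subsetI)
  fix x assume "x \<in> products (products A B) C"
  then obtain m m' a b c where
    m: "m \<in> {(\<turnstile>), (\<stileturn>), (\<perp>)}" "m' \<in> {(\<turnstile>), (\<stileturn>), (\<perp>)}"
    and x: "a \<in> A" "b \<in> B" "c \<in> C" "x = m (m' a b) c"
    unfolding products_def by blast
  obtain p q where "p \<in> {(\<turnstile>), (\<stileturn>), (\<perp>)}" "q \<in> {(\<turnstile>), (\<stileturn>), (\<perp>)}" "x = p a (q b c)"
    using rebracket_right[OF m, of a b c] x(4) by blast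
  with x(1-3) show "x \<in> products A (products B C)"
    by (auto intro: mem_products)
next
  fix x assume "x \<in> products A (products B C)"
  then obtain m m' a b c where
    m: "m \<in> {(\<turnstile>), (\<stileturn>), (\<perp>)}" "m' \<in> {(\<turnstile>), (\<stileturn>), (\<perp>)}"
    and x: "a \<in> A" "b \<in> B" "c \<in> C" "x = m a (m' b c)"
    unfolding products_def by blast
  obtain p q where "p \<in> {(\<turnstile>), (\<stileturn>), (\<perp>)}" "q \<in> {(\<turnstile>), (\<stileturn>), (\<perp>)}" "x = p (q a b) c"
    using rebracket_left[OF m, of a b c] x(4) by blast
  with x(1-3) show "x \<in> products (products A B) C"
    by (auto intro: mem_products)
qed

lemma linear_products:
  assumes "m \<in> {(\<turnstile>), (\<stileturn>), (\<perp>)}"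
  shows "Vector_Spaces.linear scale scale (m x)"
    and "Vector_Spaces.linear scale scale (\<lambda>x. m x y)"
  using assms bilinear_vd bilinear_dv bilinear_pp unfolding bilinear_product_def by auto

lemma linear_span_subset:
  assumes "Vector_Spaces.linear scale scale f" and "f ` X \<subseteq> span Y"
  shows "f ` span X \<subseteq> span Y"
proof -
  interpret f: Vector_Spaces.linear scale scale f by fact
  have "f ` span X = span (f ` X)" by (simp add: f.span_image)
  also have "\<dots> \<subseteq> span Y" using assms(2) by (simp add: span_minimal)
  finally show ?thesis .
qed

text \<open>For a fixed second factor each product is linear in the first, so it maps the span of \<open>X\<close> into
  the span of the image of \<open>X\<close>.\<close>

lemma lozenge_span_left: "span X \<lozenge> Y = X \<lozenge> Y"
proof -
  have "m x y \<in> span (products X Y)"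
    if "m \<in> {(\<turnstile>), (\<stileturn>), (\<perp>)}" "x \<in> span X" "y \<in> Y" for m x y
    using linear_span_subset[where X = X and Y = "products X Y",
        OF linear_products(2)[where y = y, OF that(1)]] that
    unfolding products_def by (blast intro: span_base)
  then have "products (span X) Y \<subseteq> span (products X Y)"
    unfolding products_def[of "span X"] by blast
  moreover have "products X Y \<subseteq> products (span X) Y"
    unfolding products_def by (blast intro: span_base)
  ultimately show ?thesis
    unfolding lozenge_eq_span by (meson span_minimal span_mono subset_antisym subspace_span)
qed

lemma lozenge_span_right: "X \<lozenge> span Y = X \<lozenge> Y"
proof -
  have "m x y \<in> span (products X Y)"
    if "m \<in> {(\<turnstile>), (\<stileturn>), (\<perp>)}" "x \<in> X" "y \<in> span Y" for m x y
    using linear_span_subset[where X = Y and Y = "products X Y",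
        OF linear_products(1)[where x = x, OF that(1)]] that
    unfolding products_def by (blast intro: span_base)
  then have "products X (span Y) \<subseteq> span (products X Y)"
    unfolding products_def[of X "span Y"] by blast
  moreover have "products X Y \<subseteq> products X (span Y)"
    unfolding products_def by (blast intro: span_base)
  ultimately show ?thesis
    unfolding lozenge_eq_span by (meson span_minimal span_mono subset_antisym subspace_span)
qed

text \<open>By bilinearity, the inner span of an iterated \<open>\<lozenge>\<close> may be dropped, so that both sides are the
  span of the same set of threefold products.\<close>

lemma lozenge_assoc: "(A \<lozenge> B) \<lozenge> C = A \<lozenge> (B \<lozenge> C)"
proof -
  have "(A \<lozenge> B) \<lozenge> C = products A B \<lozenge> C"
    by (simp only: lozenge_eq_span[of A B] lozenge_span_left)
  also have "\<dots> = A \<lozenge> products B C"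
    by (simp only: lozenge_eq_span products_assoc)
  also have "\<dots> = A \<lozenge> (B \<lozenge> C)"
    by (simp only: lozenge_eq_span[of B C] lozenge_span_right)
  finally show ?thesis .
qed

lemma left_power_lozenge: "left_power (Suc i) \<lozenge> left_power (Suc j) = left_power (Suc (Suc (i + j)))"
proof (induction j)
  case 0
  then show ?case by simp
next
  case (Suc j)
  then show ?case by (simp add: lozenge_assoc[symmetric])
qed

lemma right_power_eq_left_power: "right_power (Suc n) = left_power (Suc n)"
proof (induction n)
  case 0
  then show ?case by simp
next
  case (Suc n)
  then show ?case using left_power_lozenge[of 0 n] by simp
qed

lemma sum_const_subspace:
  assumes "subspace V" "finite I" "I \<noteq> {}"
  shows "(\<Sum>i\<in>I. V) = V"
proof -
  have "V + V = V"
    by (metis assms(1) span_Un_eq_plus span_eq_iff sup.idem)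
  with assms(2,3) show ?thesis
    by (induction rule: finite_ne_induct) auto
qed

lemma full_power_eq_left_power: "n \<ge> 1 \<Longrightarrow> full_power n = left_power n"
proof (induction n rule: full_power.induct)
  case (3 n)
  have summand: "full_power i \<lozenge> full_power (Suc (Suc n) - i) = left_power (Suc (Suc n))"
    if i: "i \<in> {1..Suc n}" for i
  proof -
    obtain k where k: "i = Suc k" "k \<le> n" using i by (cases i) auto
    then have "Suc (Suc n) - i = Suc (n - k)" by simp
    then show ?thesis using i 3 k left_power_lozenge[of k "n - k"] by simp
  qed
  have "full_power (Suc (Suc n)) = (\<Sum>i=1..Suc n. left_power (Suc (Suc n)))"
    unfolding full_power.simps using summand by (rule sum.cong[OF refl])
  also have "\<dots> = left_power (Suc (Suc n))"
    by (rule sum_const_subspace) (auto simp: lozenge_eq_span)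
  finally show ?case .
qed auto

end

theorem theorem2p2:
  fixes scale :: "'k::field \<Rightarrow> 'a::ab_group_add \<Rightarrow> 'a"
    and vd dv pp :: "'a \<Rightarrow> 'a \<Rightarrow> 'a"
    and n :: nat
  assumes "triassociative_algebra scale vd dv pp"
    and "n \<ge> 1"
  shows "triassociative_algebra.left_power scale vd dv pp n
           = triassociative_algebra.right_power scale vd dv pp n
       \<and> triassociative_algebra.right_power scale vd dv pp n
           = triassociative_algebra.full_power scale vd dv pp n"
proof -
  interpret triassociative_algebra scale vd dv pp by fact
  obtain k where "n = Suc k" using assms(2) by (cases n) auto
  then show ?thesis
    using right_power_eq_left_power[of k] full_power_eq_left_power[of n] by simp
qed

end
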